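(* \begin{enumerate} \item Every $\mathbb{S}$-connected speared domain in $\mathbb{H}$ is a hinged domain. \item Every speared domain in $\mathbb{H}$ having a main sail is a hinged domain. \end{enumerate}
   Context: Basic notation. $\mathbb{H}$ is the algebra of quaternions (Euclidean topology), $\mathbb{S}=\{w\in\mathbb{H}: w^2=-1\}$. For $I\in\mathbb{S}$: $\mathbb{C}_I=\mathbb{R}+\mathbb{R}I$, $\mathbb{C}_I^{\geqslant}=\{\alpha+\beta I:\alpha,\beta\in\mathbb{R},\beta\ge0\}$. For $T\subseteq\mathbb{H}$: $T_I^{\geqslant}=T\cap\mathbb{C}_I^{\geqslant}$. For $x=\alpha+\beta I$, $\mathbb{S}_x=\alpha+\beta\mathbb{S}$. $\mathbb{R}_{\mathbb{C}}=\mathbb{R}+\imath\mathbb{R}$ is a copy of the complex plane, with bijections $\phi_J:\mathbb{R}_{\mathbb{C}}\to\mathbb{C}_J$, $\alpha+\imath\beta\mapsto\alpha+\beta J$. A domain is a nonempty connected open subset of $\mathbb{H}$. An open $U\subseteq\mathbb{H}$ is speared if, for all $I\in\mathbb{S}$, each connected component of $U_I^{\geqslant}$ includes a real point. A speared domain is a domain that is a speared open set. An open $U\subseteq\mathbb{H}$ is $\mathbb{S}$-connected if, for each $x\in U$, the intersection $\mathbb{S}_x\cap U$ is connected. $U$ has a main sail if there exists $J_0\in\mathbb{S}$ such that $\phi_J^{-1}(U_J^{\geqslant})\subseteq\phi_{J_0}^{-1}(U_{J_0}^{\geqslant})$ for all $J\in\mathbb{S}$; then $U_{J_0}^{\geqslant}$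 is called a main sail for $U$. Hinged points. Let $\Omega$ be a speared domain. For $J,K\in\mathbb{S}$ set $E^{J,K}=\phi_J^{-1}(\Omega_J^{\geqslant})\cap\phi_K^{-1}(\Omega_K^{\geqslant})$. Let $x_0=\alpha+\beta J_0$, $x_1=\alpha+\beta J_1$, $y_0=\alpha'+\beta'J_0$, $y_1=\alpha'+\beta'J_1$ be points of $\Omega$, with $\beta,\beta'\geq0$, $J_0,J_1\in\mathbb{S}$. We say $(x_1,y_1)$ shadows $(x_0,y_0)$ in $\Omega$ if there is a path $\gamma:[0,1]\to E^{J_0,J_1}$ with $\gamma(0)=\alpha+\beta\imath$, $\gamma(1)=\alpha'+\beta'\imath$. We say $x_1$ is strongly hinged to $x_0$ in $\Omega$ if there is $y\in\Omega\cap\mathbb{R}$ such that $(x_1,y)$ shadows $(x_0,y)$. Let $t\ge1$ be an integer, $T=\{0,\dots,t\}$ and $\{x_s\}_{s=0}^t$ a finite sequence in $\Omega$. For $s,s'\in T$ with $|s-s'|=1$, there is a simple step at $s_0=\min\{s,s'\}$ if (1) $x_{s'}$ belongs to the connected component of $\mathbb{S}_{x_s}\cap\Omega$ that includes $x_s$; or (2) $x_{s'}$ is strongly hinged to $x_s$. If (1) and (2) are false but (3) there exist $s'',s'''\in T\setminus\{s,s'\}$ with $s''-s'''=s'-s$ such that $(x_{s''},x_{s'''})$ shadows $(x_s,x_{s'})$, then, with $\underline{s}=\min\{s,s',s'',s'''\}$ and $\overline{s}=\max\{s,s',s'',s'''\}-1$, there is a double step at $(\underline{s},\overline{s})$. The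 sequence is a chain of length $t$ connecting $x_0$ and $x_t$ if, after erasing from $T$ the index $t$ and all indices where a simple step happens, there remains an even number $2\ell$ of indices, which can be listed as $\underline{s}_1,\overline{s}_1,\ldots,\underline{s}_\ell,\overline{s}_\ell$ so that for all $m,n\in\{1,\dots,\ell\}$: a double step happens at $(\underline{s}_m,\overline{s}_m)$ (whence $\underline{s}_m<\overline{s}_m$); $\underline{s}_1<\ldots<\underline{s}_\ell$; and if $m<n$ then either $\overline{s}_m<\underline{s}_n$ or $\overline{s}_m>\overline{s}_n$. For $x,x'\in\Omega$, $x'$ is hinged to $x$ in $\Omega$, written $x\sim x'$, if there is a chain connecting $x$ and $x'$. A speared domain $\Omega$ is a hinged domain if, for each $x\in\Omega$, $x\sim x'$ for all $x'\in\mathbb{S}_x\cap\Omega$. *)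

theory Defs
  imports "HOL-Analysis.Analysis"
begin

section \<open>The quaternions as a Euclidean space and a real normed division algebra\<close>

datatype quat = Quat (qre: real) (qi: real) (qj: real) (qk: real)

lemma quat_eq_iff: "x = y \<longleftrightarrow> qre x = qre y \<and> qi x = qi y \<and> qj x = qj y \<and> qk x = qk y"
  by (cases x; cases y) auto

instantiation quat :: ab_group_add
begin

definition zero_quat :: quat where "0 = Quat 0 0 0 0"

definition plus_quat :: "quat \<Rightarrow> quat \<Rightarrow> quat" where
  "x + y = Quat (qre x + qre y) (qi x + qi y) (qj x + qj y) (qk x + qk y)"

definition uminus_quat :: "quat \<Rightarrow> quat" where
  "- x = Quat (- qre x) (- qi x) (- qj x) (- qk x)"

definition minus_quat :: "quat \<Rightarrow> quat \<Rightarrow> quat" where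
  "x - y = Quat (qre x - qre y) (qi x - qi y) (qj x - qj y) (qk x - qk y)"

instance
  by standard (auto simp: zero_quat_def plus_quat_def uminus_quat_def minus_quat_def quat_eq_iff)

end

lemma quat_zero_simps [simp]: "qre 0 = 0" "qi 0 = 0" "qj 0 = 0" "qk 0 = 0"
  by (simp_all add: zero_quat_def)

lemma quat_add_simps [simp]:
  "qre (x + y) = qre x + qre y" "qi (x + y) = qi x + qi y"
  "qj (x + y) = qj x + qj y" "qk (x + y) = qk x + qk y"
  by (simp_all add: plus_quat_def)

lemma quat_uminus_simps [simp]:
  "qre (- x) = - qre x" "qi (- x) = - qi x" "qj (- x) = - qj x" "qk (- x) = - qk x"
  by (simp_all add: uminus_quat_def)

lemma quat_diff_simps [simp]:
  "qre (x - y) = qre x - qre y" "qi (x - y) = qi x - qi y"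
  "qj (x - y) = qj x - qj y" "qk (x - y) = qk x - qk y"
  by (simp_all add: minus_quat_def)

instantiation quat :: ring_1
begin

definition one_quat :: quat where "1 = Quat 1 0 0 0"

definition times_quat :: "quat \<Rightarrow> quat \<Rightarrow> quat" where
  "x * y = Quat
     (qre x * qre y - qi x * qi y - qj x * qj y - qk x * qk y)
     (qre x * qi y + qi x * qre y + qj x * qk y - qk x * qj y)
     (qre x * qj y - qi x * qk y + qj x * qre y + qk x * qi y)
     (qre x * qk y + qi x * qj y - qj x * qi y + qk x * qre y)"

instance
  by standard (auto simp: one_quat_def times_quat_def quat_eq_iff algebra_simps)

end

lemma quat_one_simps [simp]: "qre 1 = 1" "qi 1 = 0" "qj 1 = 0" "qk 1 = 0"
  by (simp_all add: one_quat_def)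

lemma quat_mult_simps [simp]:
  "qre (x * y) = qre x * qre y - qi x * qi y - qj x * qj y - qk x * qk y"
  "qi (x * y) = qre x * qi y + qi x * qre y + qj x * qk y - qk x * qj y"
  "qj (x * y) = qre x * qj y - qi x * qk y + qj x * qre y + qk x * qi y"
  "qk (x * y) = qre x * qk y + qi x * qj y - qj x * qi y + qk x * qre y"
  by (simp_all add: times_quat_def)

instantiation quat :: real_algebra_1
begin

definition scaleR_quat :: "real \<Rightarrow> quat \<Rightarrow> quat" where
  "scaleR r x = Quat (r * qre x) (r * qi x) (r * qj x) (r * qk x)"

instance
  by standard (auto simp: scaleR_quat_def quat_eq_iff algebra_simps)

end

lemma quat_scaleR_simps [simp]:
  "qre (r *\<^sub>R x) = r * qre x" "qi (r *\<^sub>R x) = r * qi x"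
  "qj (r *\<^sub>R x) = r * qj x" "qk (r *\<^sub>R x) = r * qk x"
  by (simp_all add: scaleR_quat_def)

lemma quat_of_real_simps [simp]:
  "qre (of_real r) = r" "qi (of_real r) = 0" "qj (of_real r) = 0" "qk (of_real r) = 0"
  by (simp_all add: of_real_def)

instantiation quat :: real_inner
begin

definition inner_quat :: "quat \<Rightarrow> quat \<Rightarrow> real" where
  "inner x y = qre x * qre y + qi x * qi y + qj x * qj y + qk x * qk y"

definition norm_quat :: "quat \<Rightarrow> real" where
  "norm_quat x = sqrt (inner x x)"

definition sgn_quat :: "quat \<Rightarrow> quat" where
  "sgn_quat x = x /\<^sub>R norm x"

definition dist_quat :: "quat \<Rightarrow> quat \<Rightarrow> real" where
  "dist_quat x y = norm (x - y)"

definition uniformity_quat :: "(quat \<times> quat) filter" where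
  "uniformity_quat = (INF e\<in>{0 <..}. principal {(x, y). dist x y < e})"

definition open_quat :: "quat set \<Rightarrow> bool" where
  "open_quat U \<longleftrightarrow> (\<forall>x\<in>U. eventually (\<lambda>(x', y). x' = x \<longrightarrow> y \<in> U) uniformity)"

instance
proof
  fix x y z :: quat and r :: real and U :: "quat set"
  show "dist x y = norm (x - y)" by (rule dist_quat_def)
  show "sgn x = x /\<^sub>R norm x" by (rule sgn_quat_def)
  show "uniformity = (INF e\<in>{0 <..}. principal {(x, y::quat). dist x y < e})"
    by (rule uniformity_quat_def)
  show "open U \<longleftrightarrow> (\<forall>x\<in>U. \<forall>\<^sub>F (x', y) in uniformity. x' = x \<longrightarrow> y \<in> U)"
    by (rule open_quat_def)
  show "inner x y = inner y x" by (simp add: inner_quat_def mult.commute)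
  show "inner (x + y) z = inner x z + inner y z" by (simp add: inner_quat_def algebra_simps)
  show "inner (r *\<^sub>R x) y = r * inner x y" by (simp add: inner_quat_def algebra_simps)
  show "0 \<le> inner x x" by (simp add: inner_quat_def)
  show "inner x x = 0 \<longleftrightarrow> x = 0"
    by (simp add: inner_quat_def quat_eq_iff add_nonneg_eq_0_iff)
  show "norm x = sqrt (inner x x)" by (rule norm_quat_def)
qed

end

instantiation quat :: euclidean_space
begin

definition Basis_quat :: "quat set" where
  "Basis = {Quat 1 0 0 0, Quat 0 1 0 0, Quat 0 0 1 0, Quat 0 0 0 1}"

instance
proof
  show "(Basis :: quat set) \<noteq> {}" "finite (Basis :: quat set)"
    by (simp_all add: Basis_quat_def)
  show "inner u v = (if u = v then 1 else 0)" if "u \<in> Basis" "v \<in> Basis" for u v :: quat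
    using that unfolding Basis_quat_def by (elim insertE emptyE) (simp_all add: inner_quat_def)
  show "(\<forall>u\<in>Basis. inner x u = 0) \<longleftrightarrow> x = 0" for x :: quat
    by (simp add: Basis_quat_def inner_quat_def) (simp add: quat_eq_iff)
qed

end

instantiation quat :: real_normed_div_algebra
begin

definition inverse_quat :: "quat \<Rightarrow> quat" where
  "inverse x = Quat (qre x) (- qi x) (- qj x) (- qk x) /\<^sub>R (norm x)\<^sup>2"

definition divide_quat :: "quat \<Rightarrow> quat \<Rightarrow> quat" where
  "divide_quat x y = x * inverse y"

instance
proof
  fix x y :: quat
  have n: "(norm z)\<^sup>2 = qre z * qre z + qi z * qi z + qj z * qj z + qk z * qk z" for z :: quat
    by (simp add: power2_norm_eq_inner inner_quat_def)
  show "x \<noteq> 0 \<Longrightarrow> inverse x * x = 1" "x \<noteq> 0 \<Longrightarrow> x * inverse x = 1"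
  proof -
    assume "x \<noteq> 0"
    then have nz: "(norm x)\<^sup>2 \<noteq> 0" by simp
    have c: "Quat (qre x) (- qi x) (- qj x) (- qk x) * x = (norm x)\<^sup>2 *\<^sub>R 1"
      "x * Quat (qre x) (- qi x) (- qj x) (- qk x) = (norm x)\<^sup>2 *\<^sub>R 1"
      unfolding n by (simp_all add: quat_eq_iff algebra_simps)
    show "inverse x * x = 1" "x * inverse x = 1"
      using nz by (simp_all add: inverse_quat_def c)
  qed
  show "x div y = x * inverse y" by (rule divide_quat_def)
  show "inverse (0::quat) = 0" by (simp add: inverse_quat_def)
  have "(norm (x * y))\<^sup>2 = (norm x * norm y)\<^sup>2"
    unfolding power_mult_distrib n quat_mult_simps by algebra
  then show "norm (x * y) = norm x * norm y"
    by (rule power2_eq_imp_eq) simp_all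
qed

end


section \<open>Slices, spheres and speared domains\<close>

definition im_units :: "quat set" where
  "im_units = {w. w\<^sup>2 = - 1}"

text \<open>The complex plane \<open>\<real> + \<iota>\<real>\<close> is the type \<open>complex\<close>.\<close>

definition slice_map :: "quat \<Rightarrow> complex \<Rightarrow> quat" where
  "slice_map J z = of_real (Re z) + of_real (Im z) * J"

definition half_slice :: "quat \<Rightarrow> quat set" where
  "half_slice I = {of_real \<alpha> + of_real \<beta> * I |\<alpha> \<beta>. \<beta> \<ge> 0}"

definition sail :: "quat set \<Rightarrow> quat \<Rightarrow> quat set" where
  "sail T I = T \<inter> half_slice I"

text \<open>
  The set \<open>\<alpha> + \<beta>\<S>\<close> is the same for all representations \<open>x = \<alpha> + \<beta>I\<close> of \<open>x\<close>, so the
  following union over all representations is just that set.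
\<close>

definition sphere_of :: "quat \<Rightarrow> quat set" where
  "sphere_of x = {of_real \<alpha> + of_real \<beta> * J |\<alpha> \<beta> J.
     J \<in> im_units \<and> (\<exists>I\<in>im_units. x = of_real \<alpha> + of_real \<beta> * I)}"

definition speared_open :: "quat set \<Rightarrow> bool" where
  "speared_open U \<longleftrightarrow>
     open U \<and> (\<forall>I\<in>im_units. \<forall>C\<in>components (sail U I). C \<inter> \<real> \<noteq> {})"

definition quat_domain :: "quat set \<Rightarrow> bool" where
  "quat_domain U \<longleftrightarrow> open U \<and> connected U \<and> U \<noteq> {}"

definition speared_domain :: "quat set \<Rightarrow> bool" where
  "speared_domain U \<longleftrightarrow> quat_domain U \<and> speared_open U"

definition S_connected :: "quat set \<Rightarrow> bool" where
  "S_connected U \<longleftrightarrow> open U \<and> (\<forall>x\<in>U. connected (sphere_of x \<inter> U))"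

definition has_main_sail :: "quat set \<Rightarrow> bool" where
  "has_main_sail U \<longleftrightarrow>
     (\<exists>J\<^sub>0\<in>im_units. \<forall>J\<in>im_units. slice_map J -` sail U J \<subseteq> slice_map J\<^sub>0 -` sail U J\<^sub>0)"


section \<open>Hinged points and hinged domains\<close>

definition sail_overlap :: "quat set \<Rightarrow> quat \<Rightarrow> quat \<Rightarrow> complex set" where
  "sail_overlap \<Omega> J K = slice_map J -` sail \<Omega> J \<inter> slice_map K -` sail \<Omega> K"

text \<open>
  \<open>shadows \<Omega> (x\<^sub>1, y\<^sub>1) (x\<^sub>0, y\<^sub>0)\<close>: the pair \<open>(x\<^sub>1, y\<^sub>1)\<close> shadows \<open>(x\<^sub>0, y\<^sub>0)\<close>.  A real point lies in every
  slice, hence the imaginary units are not determined by the four points and are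
  quantified existentially.
\<close>

definition shadows :: "quat set \<Rightarrow> quat \<times> quat \<Rightarrow> quat \<times> quat \<Rightarrow> bool" where
  "shadows \<Omega> = (\<lambda>(x\<^sub>1, y\<^sub>1) (x\<^sub>0, y\<^sub>0).
     x\<^sub>0 \<in> \<Omega> \<and> x\<^sub>1 \<in> \<Omega> \<and> y\<^sub>0 \<in> \<Omega> \<and> y\<^sub>1 \<in> \<Omega> \<and>
     (\<exists>\<alpha> \<beta> \<alpha>' \<beta>' J\<^sub>0 J\<^sub>1. \<beta> \<ge> 0 \<and> \<beta>' \<ge> 0 \<and> J\<^sub>0 \<in> im_units \<and> J\<^sub>1 \<in> im_units \<and>
        x\<^sub>0 = of_real \<alpha> + of_real \<beta> * J\<^sub>0 \<and> x\<^sub>1 = of_real \<alpha> + of_real \<beta> * J\<^sub>1 \<and>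
        y\<^sub>0 = of_real \<alpha>' + of_real \<beta>' * J\<^sub>0 \<and> y\<^sub>1 = of_real \<alpha>' + of_real \<beta>' * J\<^sub>1 \<and>
        (\<exists>\<gamma>. path \<gamma> \<and> path_image \<gamma> \<subseteq> sail_overlap \<Omega> J\<^sub>0 J\<^sub>1 \<and>
             pathstart \<gamma> = Complex \<alpha> \<beta> \<and> pathfinish \<gamma> = Complex \<alpha>' \<beta>')))"

definition strongly_hinged :: "quat set \<Rightarrow> quat \<Rightarrow> quat \<Rightarrow> bool" where
  "strongly_hinged \<Omega> x\<^sub>1 x\<^sub>0 \<longleftrightarrow> (\<exists>y \<in> \<Omega> \<inter> \<real>. shadows \<Omega> (x\<^sub>1, y) (x\<^sub>0, y))"

text \<open>
  In the following, a sequence \<open>x\<^sub>0, \<dots>, x\<^sub>t\<close> is a function on \<open>nat\<close> of which only the values at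
  indices up to \<open>t\<close> are used.  \<open>simple_pair\<close> is the disjunction of conditions (1) and (2).
\<close>

definition simple_pair :: "quat set \<Rightarrow> quat \<Rightarrow> quat \<Rightarrow> bool" where
  "simple_pair \<Omega> a b \<longleftrightarrow>
     b \<in> connected_component_set (sphere_of a \<inter> \<Omega>) a \<or> strongly_hinged \<Omega> b a"

definition simple_step :: "quat set \<Rightarrow> nat \<Rightarrow> (nat \<Rightarrow> quat) \<Rightarrow> nat \<Rightarrow> bool" where
  "simple_step \<Omega> t x k \<longleftrightarrow>
     (\<exists>s\<in>{0..t}. \<exists>s'\<in>{0..t}. \<bar>int s - int s'\<bar> = 1 \<and> k = min s s' \<and> simple_pair \<Omega> (x s) (x s'))"

definition double_step :: "quat set \<Rightarrow> nat \<Rightarrow> (nat \<Rightarrow> quat) \<Rightarrow> nat \<times> nat \<Rightarrow> bool" where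
  "double_step \<Omega> t x = (\<lambda>(lo, hi).
     (\<exists>s\<in>{0..t}. \<exists>s'\<in>{0..t}. \<bar>int s - int s'\<bar> = 1 \<and> \<not> simple_pair \<Omega> (x s) (x s') \<and>
        (\<exists>s''\<in>{0..t} - {s, s'}. \<exists>s'''\<in>{0..t} - {s, s'}.
           int s'' - int s''' = int s' - int s \<and>
           shadows \<Omega> (x s'', x s''') (x s, x s') \<and>
           lo = Min {s, s', s'', s'''} \<and> hi = Max {s, s', s'', s'''} - 1)))"

definition is_chain :: "quat set \<Rightarrow> nat \<Rightarrow> (nat \<Rightarrow> quat) \<Rightarrow> bool" where
  "is_chain \<Omega> t x \<longleftrightarrow> t \<ge> 1 \<and> (\<forall>s\<in>{0..t}. x s \<in> \<Omega>) \<and>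
     (let R = {0..t} - {t} - {k. simple_step \<Omega> t x k} in
      \<exists>l lo hi. card R = 2 * l \<and> R = lo ` {1..l} \<union> hi ` {1..l} \<and>
        (\<forall>m\<in>{1..l}. double_step \<Omega> t x (lo m, hi m)) \<and>
        strict_mono_on {1..l} lo \<and>
        (\<forall>m\<in>{1..l}. \<forall>n\<in>{1..l}. m < n \<longrightarrow> hi m < lo n \<or> hi m > hi n))"

definition hinged :: "quat set \<Rightarrow> quat \<Rightarrow> quat \<Rightarrow> bool" where
  "hinged \<Omega> x x' \<longleftrightarrow> (\<exists>t c. is_chain \<Omega> t c \<and> c 0 = x \<and> c t = x')"

definition hinged_domain :: "quat set \<Rightarrow> bool" where
  "hinged_domain \<Omega> \<longleftrightarrow>
     speared_domain \<Omega> \<and> (\<forall>x\<in>\<Omega>. \<forall>x'\<in>sphere_of x \<inter> \<Omega>. hinged \<Omega> x x')"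

end

theory Submission
  imports Defs
begin

text \<open>
  On an S-connected domain a chain of length one suffices, as \<open>x\<close> and \<open>x'\<close> lie in the same connected
  component of their sphere.  If there is a main sail with unit \<open>J\<^sub>0\<close>, then \<open>\<alpha> + \<beta>I\<close> is connected to
  the real axis by a path in its own sail; the copy of this path in the main sail shows that
  \<open>\<alpha> + \<beta>J\<^sub>0\<close> is strongly hinged to \<open>\<alpha> + \<beta>I\<close>, so that any two points of a sphere are hinged in two
  simple steps through \<open>\<alpha> + \<beta>J\<^sub>0\<close>.
\<close>

section \<open>Imaginary units and spheres\<close>

lemma im_units_qre:
  assumes "w \<in> im_units"
  shows "qre w = 0"
proof (rule ccontr)
  assume a: "qre w \<noteq> 0"
  have e: "w * w = - 1"
    using assms by (simp add: im_units_def power2_eq_square)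
  \<comment> \<open>The imaginary components of \<open>w * w\<close> are \<open>2 * qre w\<close>
    times those of \<open>w\<close>, so \<open>w\<close> would be real with a negative
    square.\<close>
  have "qi w = 0" "qj w = 0" "qk w = 0"
    using e a by (simp_all add: quat_eq_iff)
  then have "qre w * qre w = - 1"
    using e by (simp add: quat_eq_iff)
  then show False
    using zero_le_square[of "qre w"] by linarith
qed

lemma im_units_inner_self:
  assumes "w \<in> im_units"
  shows "inner w w = 1"
proof -
  have "w * w = - 1"
    using assms by (simp add: im_units_def power2_eq_square)
  with im_units_qre[OF assms] show ?thesis
    by (simp add: quat_eq_iff inner_quat_def)
qed

lemma im_units_uminus: "w \<in> im_units \<Longrightarrow> - w \<in> im_units"
  by (simp add: im_units_def)

text \<open>Changing the signs of \<beta>, \<open>I\<close> and \<open>J\<close> together moves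
  neither point, so \<beta> can be taken nonnegative, as sails and shadowing demand.\<close>

lemma sphere_of_cases:
  assumes "x' \<in> sphere_of x"
  obtains \<alpha> \<beta> I J where "\<beta> \<ge> 0" "I \<in> im_units" "J \<in> im_units"
    "x = of_real \<alpha> + of_real \<beta> * I" "x' = of_real \<alpha> + of_real \<beta> * J"
proof -
  obtain \<alpha> \<beta> I J where *: "I \<in> im_units" "J \<in> im_units"
    "x = of_real \<alpha> + of_real \<beta> * I" "x' = of_real \<alpha> + of_real \<beta> * J"
    using assms by (auto simp: sphere_of_def)
  show thesis
  proof (cases "\<beta> \<ge> 0")
    case True
    with * show ?thesis by (intro that)
  next
    case False
    with * show ?thesis
      by (intro that[of "- \<beta>" "- I" "- J" \<alpha>]) (auto intro: im_units_uminus)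
  qed
qed

section \<open>Sails viewed in the complex plane\<close>

lemma continuous_on_slice_map [continuous_intros]: "continuous_on S (slice_map J)"
  unfolding slice_map_def by (intro continuous_intros)

text \<open>A unit \<open>J\<close> has norm one and is orthogonal to the reals, so pairing with
  \<open>J\<close> recovers the imaginary part. This left inverse is defined and continuous on all
  quaternions, so it can carry connected sets back to the plane.\<close>

lemma slice_map_inverse:
  assumes "J \<in> im_units"
  shows "Complex (qre (slice_map J z)) (inner (slice_map J z) J) = z"
proof -
  have "inner (of_real a) J = 0" for a
    using im_units_qre[OF assms] by (simp add: inner_quat_def)
  moreover have "of_real b * J = b *\<^sub>R J" for b
    by (simp add: scaleR_conv_of_real)
  ultimately show ?thesis
    using im_units_qre[OF assms] im_units_inner_self[OF assms]
    by (simp add: slice_map_def complex_eq_iff inner_add_left)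
qed

lemma slice_map_vimage_sail:
  assumes "J \<in> im_units"
  shows "slice_map J -` sail U J = {z. Im z \<ge> 0 \<and> slice_map J z \<in> U}" (is "?L = ?R")
proof
  show "?L \<subseteq> ?R"
  proof
    fix z assume z: "z \<in> ?L"
    then obtain \<alpha> \<beta> where ab: "slice_map J z = of_real \<alpha> + of_real \<beta> * J" "\<beta> \<ge> 0"
      by (auto simp: sail_def half_slice_def)
    then have "slice_map J z = slice_map J (Complex \<alpha> \<beta>)"
      by (simp add: slice_map_def)
    then have "z = Complex \<alpha> \<beta>"
      using slice_map_inverse[OF assms] by metis
    with ab z show "z \<in> ?R" by (auto simp: sail_def)
  qed
  show "?R \<subseteq> ?L"
    by (auto simp: sail_def half_slice_def slice_map_def)
qed

text \<open>The set is relatively open in the closed upper half-plane, which is convex and hence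
  locally path connected.\<close>

lemma locally_path_connected_vimage_sail:
  assumes "open U" "J \<in> im_units"
  shows "locally path_connected (slice_map J -` sail U J)"
proof -
  let ?H = "{z. Im z \<ge> 0}"
  have "open (slice_map J -` U)"
    using assms(1) by (intro open_vimage continuous_intros)
  then have "openin (top_of_set ?H) (?H \<inter> slice_map J -` U)"
    by (rule openin_open_Int)
  moreover have "locally path_connected ?H"
    by (intro convex_imp_locally_path_connected convex_halfspace_Im_ge)
  ultimately have "locally path_connected (?H \<inter> slice_map J -` U)"
    by (rule locally_open_subset[rotated])
  also have "?H \<inter> slice_map J -` U = slice_map J -` sail U J"
    unfolding slice_map_vimage_sail[OF assms(2)] by auto
  finally show ?thesis .
qed

text \<open>Being speared concerns connected components among quaternions, whereas shadowing needs
  paths in the plane. The left inverse \<open>?g\<close> maps the component of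
  \<open>slice_map J z\<close> to a connected plane set containing \<open>z\<close> and a real
  number; local path connectedness then yields a path.\<close>

lemma speared_open_path_to_real:
  assumes U: "speared_open U" and J: "J \<in> im_units" and z: "z \<in> slice_map J -` sail U J"
  obtains r where "path_component (slice_map J -` sail U J) z (of_real r)"
proof -
  let ?P = "slice_map J -` sail U J"
  let ?g = "\<lambda>q. Complex (qre q) (inner q J)"
  let ?C = "connected_component_set (sail U J) (slice_map J z)"
  have zs: "slice_map J z \<in> sail U J" using z by simp
  then have "?C \<in> components (sail U J)"
    by (rule componentsI)
  then obtain y where y: "y \<in> ?C" "y \<in> \<real>"
    using U J unfolding speared_open_def by blast
  have "continuous_on ?C ?g"
  proof -
    have qre_inner: "qre q = inner q 1" for q
      by (simp add: inner_quat_def)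
    show ?thesis
      unfolding Complex_eq qre_inner
      by (intro continuous_on_add continuous_on_mult continuous_on_of_real continuous_on_inner
          continuous_on_const continuous_on_id)
  qed
  then have conn: "connected (?g ` ?C)"
    by (rule connected_continuous_image) simp
  have "?g ` ?C \<subseteq> ?P"
  proof
    fix w assume "w \<in> ?g ` ?C"
    then obtain q where q: "q \<in> sail U J" "w = ?g q"
      using connected_component_subset by blast
    then obtain \<alpha> \<beta> where ab: "q = slice_map J (Complex \<alpha> \<beta>)"
      by (auto simp: sail_def half_slice_def slice_map_def)
    have "w = Complex \<alpha> \<beta>"
      unfolding q(2) ab by (rule slice_map_inverse[OF J])
    with q ab show "w \<in> ?P" by simp
  qed
  moreover have "z \<in> ?g ` ?C"
  proof (rule image_eqI)
    show "z = ?g (slice_map J z)" using slice_map_inverse[OF J] by metis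
    show "slice_map J z \<in> ?C" using zs by simp
  qed
  ultimately have "connected_component ?P z (?g y)"
    using conn y(1) unfolding connected_component_def by blast
  moreover obtain r where "y = of_real r"
    using y(2) by (auto simp: Reals_def)
  then have "?g y = of_real r"
    using im_units_qre[OF J] by (simp add: inner_quat_def complex_eq_iff)
  moreover have "locally path_connected ?P"
    using U J by (intro locally_path_connected_vimage_sail) (auto simp: speared_open_def)
  ultimately have "path_component ?P z (of_real r)"
    by (metis path_component_eq_connected_component)
  then show thesis by (rule that)
qed

section \<open>Shadowing and strong hinging\<close>

lemma shadowsI:
  assumes "I \<in> im_units" "J \<in> im_units" "0 \<le> \<beta>" "0 \<le> \<beta>'"
    "x = of_real \<alpha> + of_real \<beta> * I" "x' = of_real \<alpha> + of_real \<beta> * J"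
    "y = of_real \<alpha>' + of_real \<beta>' * I" "y' = of_real \<alpha>' + of_real \<beta>' * J"
    "x \<in> \<Omega>" "x' \<in> \<Omega>" "y \<in> \<Omega>" "y' \<in> \<Omega>"
    "path \<gamma>" "path_image \<gamma> \<subseteq> sail_overlap \<Omega> I J"
    "pathstart \<gamma> = Complex \<alpha> \<beta>" "pathfinish \<gamma> = Complex \<alpha>' \<beta>'"
  shows "shadows \<Omega> (x', y') (x, y)"
  unfolding shadows_def prod.case
  by ((rule conjI, rule assms)+, rule exI[of _ \<alpha>], rule exI[of _ \<beta>], rule exI[of _ \<alpha>'],
      rule exI[of _ \<beta>'], rule exI[of _ I], rule exI[of _ J], intro conjI exI[of _ \<gamma>] assms)

text \<open>The overlap of two sails is symmetric in the units, so the same path serves with the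
  units exchanged.\<close>

lemma shadows_sym:
  assumes "shadows \<Omega> (x, y) (x', y')"
  shows "shadows \<Omega> (x', y') (x, y)"
proof -
  from assms obtain \<alpha> \<beta> \<alpha>' \<beta>' I J \<gamma> where
    "x' \<in> \<Omega>" "x \<in> \<Omega>" "y' \<in> \<Omega>" "y \<in> \<Omega>" "\<beta> \<ge> 0" "\<beta>' \<ge> 0" "I \<in> im_units" "J \<in> im_units"
    "x' = of_real \<alpha> + of_real \<beta> * I" "x = of_real \<alpha> + of_real \<beta> * J"
    "y' = of_real \<alpha>' + of_real \<beta>' * I" "y = of_real \<alpha>' + of_real \<beta>' * J"
    "path \<gamma>" "path_image \<gamma> \<subseteq> sail_overlap \<Omega> J I"
    "pathstart \<gamma> = Complex \<alpha> \<beta>" "pathfinish \<gamma> = Complex \<alpha>' \<beta>'"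
    unfolding shadows_def prod.case sail_overlap_def by (elim conjE exE) (simp add: Int_commute)
  then show ?thesis
    by (intro shadowsI[of J I \<beta> \<beta>' x \<alpha> x' y \<alpha>' y' \<Omega> \<gamma>])
qed

lemma strongly_hinged_sym: "strongly_hinged \<Omega> x y \<Longrightarrow> strongly_hinged \<Omega> y x"
  unfolding strongly_hinged_def by (blast intro: shadows_sym)

text \<open>By \<open>sub\<close>, the overlap is the whole plane copy of the sail of
  \<open>I\<close>, so a path to the real axis inside that sail already lies in it. Its endpoint has
  height 0 and thus gives the same quaternion for both units.\<close>

lemma strongly_hinged_of_sail_subset:
  assumes U: "speared_open \<Omega>" and I: "I \<in> im_units" and J: "J \<in> im_units"
    and sub: "slice_map I -` sail \<Omega> I \<subseteq> slice_map J -` sail \<Omega> J"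
    and b: "\<beta> \<ge> 0" and x: "of_real \<alpha> + of_real \<beta> * I \<in> \<Omega>"
  shows "strongly_hinged \<Omega> (of_real \<alpha> + of_real \<beta> * J) (of_real \<alpha> + of_real \<beta> * I)"
proof -
  let ?z = "Complex \<alpha> \<beta>"
  have z: "?z \<in> slice_map I -` sail \<Omega> I"
    using x b by (simp add: slice_map_vimage_sail[OF I]) (simp add: slice_map_def)
  obtain r \<gamma> where \<gamma>: "path \<gamma>" "path_image \<gamma> \<subseteq> slice_map I -` sail \<Omega> I"
    "pathstart \<gamma> = ?z" "pathfinish \<gamma> = of_real r"
    using speared_open_path_to_real[OF U I z] unfolding path_component_def by metis
  then have "of_real r \<in> slice_map I -` sail \<Omega> I"
    using pathfinish_in_path_image[of \<gamma>] by auto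
  then have r: "of_real r \<in> \<Omega>"
    by (simp add: sail_def slice_map_def)
  have "of_real \<alpha> + of_real \<beta> * J \<in> \<Omega>"
    using subsetD[OF sub z] by (simp add: sail_def slice_map_def)
  moreover have "path_image \<gamma> \<subseteq> sail_overlap \<Omega> I J"
    using \<gamma>(2) sub by (auto simp: sail_overlap_def)
  ultimately have "shadows \<Omega> (of_real \<alpha> + of_real \<beta> * J, of_real r)
      (of_real \<alpha> + of_real \<beta> * I, of_real r)"
    using r x \<gamma> b I J
    by (intro shadowsI[of I J \<beta> 0 _ \<alpha> _ _ r _ \<Omega> \<gamma>]) (simp_all add: complex_eq_iff)
  with r show ?thesis
    unfolding strongly_hinged_def by (intro bexI[of _ "of_real r"]) simp_all
qed

section \<open>Chains made of simple steps\<close>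

lemma is_chain_of_simple_pairs:
  assumes "t \<ge> 1" "\<And>s. s \<le> t \<Longrightarrow> c s \<in> \<Omega>" "\<And>s. s < t \<Longrightarrow> simple_pair \<Omega> (c s) (c (Suc s))"
  shows "is_chain \<Omega> t c"
proof -
  have "simple_step \<Omega> t c s" if "s < t" for s
    unfolding simple_step_def using that assms(3)[OF that]
    by (intro bexI[of _ s] bexI[of _ "Suc s"]) auto
  then have R: "{0..t} - {t} - {k. simple_step \<Omega> t c k} = {}"
    by force
  \<comment> \<open>Every index is erased, so the number of double steps is 0 and the conditions on
    \<open>lo\<close> and \<open>hi\<close> are vacuous.\<close>
  show ?thesis
    unfolding is_chain_def Let_def R using assms(1,2)
    by (intro conjI exI[of _ "0::nat"]) (auto simp: strict_mono_on_def)
qed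

lemma hinged_two_simple_pairs:
  assumes "x \<in> \<Omega>" "y \<in> \<Omega>" "x' \<in> \<Omega>" "simple_pair \<Omega> x y" "simple_pair \<Omega> y x'"
  shows "hinged \<Omega> x x'"
proof -
  \<comment> \<open>The default value \<open>x'\<close> supplies the entry at index 2.\<close>
  let ?c = "(\<lambda>_. x')(0 := x, 1 := y)"
  have "is_chain \<Omega> 2 ?c"
    using assms by (intro is_chain_of_simple_pairs) (auto simp: less_2_cases_iff)
  then show ?thesis
    unfolding hinged_def by (intro exI[of _ 2] exI[of _ ?c]) simp
qed

lemma S_connected_imp_hinged_domain:
  assumes "speared_domain \<Omega>" "S_connected \<Omega>"
  shows "hinged_domain \<Omega>"
  unfolding hinged_domain_def
proof (intro conjI ballI)
  fix x x' assume x: "x \<in> \<Omega>" and x': "x' \<in> sphere_of x \<inter> \<Omega>"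
  from x' have "x' \<in> sphere_of x" by simp
  \<comment> \<open>A member of the sphere comes with a representation of \<open>x\<close> over some
    unit \<open>I\<close>; choosing \<open>J\<close> equal to \<open>I\<close> puts \<open>x\<close>
    itself in the sphere.\<close>
  then have "x \<in> sphere_of x"
    by (auto simp: sphere_of_def)
  moreover have "connected (sphere_of x \<inter> \<Omega>)"
    using assms(2) x by (simp add: S_connected_def)
  ultimately have "simple_pair \<Omega> x x'"
    using x x' by (auto simp: simple_pair_def connected_component_def)
  then have "is_chain \<Omega> 1 ((\<lambda>_. x')(0 := x))"
    using x x' by (intro is_chain_of_simple_pairs) auto
  then show "hinged \<Omega> x x'"
    unfolding hinged_def by (intro exI[of _ 1] exI[of _ "(\<lambda>_. x')(0 := x)"]) simp
qed (rule assms)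

lemma has_main_sail_imp_hinged_domain:
  assumes \<Omega>: "speared_domain \<Omega>" and main: "has_main_sail \<Omega>"
  shows "hinged_domain \<Omega>"
  unfolding hinged_domain_def
proof (intro conjI ballI)
  fix x x' assume x: "x \<in> \<Omega>" and x': "x' \<in> sphere_of x \<inter> \<Omega>"
  obtain K where K: "K \<in> im_units"
    "\<And>J. J \<in> im_units \<Longrightarrow> slice_map J -` sail \<Omega> J \<subseteq> slice_map K -` sail \<Omega> K"
    using main unfolding has_main_sail_def by blast
  have U: "speared_open \<Omega>"
    using \<Omega> by (simp add: speared_domain_def)
  from x' have "x' \<in> sphere_of x" by simp
  then obtain \<alpha> \<beta> I J where b: "\<beta> \<ge> 0" and I: "I \<in> im_units" and J: "J \<in> im_units"
    and xI: "x = of_real \<alpha> + of_real \<beta> * I" and xJ: "x' = of_real \<alpha> + of_real \<beta> * J"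
    by (rule sphere_of_cases)
  let ?y = "of_real \<alpha> + of_real \<beta> * K"
  have 1: "strongly_hinged \<Omega> ?y x"
    using strongly_hinged_of_sail_subset[OF U I K(1) K(2)[OF I] b] x xI by simp
  have 2: "strongly_hinged \<Omega> ?y x'"
    using strongly_hinged_of_sail_subset[OF U J K(1) K(2)[OF J] b] x' xJ by simp
  have "?y \<in> \<Omega>"
    using 1 by (auto simp: strongly_hinged_def shadows_def)
  \<comment> \<open>The chain runs from \<open>x\<close> to \<open>?y\<close> to \<open>x'\<close>,
    so the second hinge has to be reversed.\<close>
  then show "hinged \<Omega> x x'"
    using x x' 1 strongly_hinged_sym[OF 2]
    by (intro hinged_two_simple_pairs[of x \<Omega> ?y x']) (auto simp: simple_pair_def)
qed (rule \<Omega>)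

theorem proposition6p9:
  shows "(\<forall>\<Omega>. speared_domain \<Omega> \<and> S_connected \<Omega> \<longrightarrow> hinged_domain \<Omega>) \<and>
         (\<forall>\<Omega>. speared_domain \<Omega> \<and> has_main_sail \<Omega> \<longrightarrow> hinged_domain \<Omega>)"
  using S_connected_imp_hinged_domain has_main_sail_imp_hinged_domain by blast

end
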